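(* Let $n\ge 1$ be an integer, and let $r$ be either a positive integer or an indeterminate over $\mathbb{Q}$. Let $b_k=b_k(r)=\binom{k+r-1}{r}$ for $k\ge 1$, and let $R_n(b_k)$ be the $n\times n$ matrix whose $(i,j)$-entry is $1/b_{i+j-1}$ for $1\le i,j\le n$. Let $B(n,r)$ be the $n\times n$ matrix whose $(i,j)$-entry ($1\le i,j\le n$) is $$B_{ij}(n,r)=\sum_{k=0}^{j-1}(-1)^{i+k+1}\binom{n+i+r-2}{i}\binom{n}{i}\binom{n+k+r-2}{k}\binom{n}{k}\,\frac{i^2\prod_{l=0}^{r-3}(i+j+l)}{r\prod_{l=0}^{r-2}(i+k+l)}.$$ Then $B(n,r)$ is the inverse of the matrix $R_n(b_k)$.
   Context: When $r$ is an indeterminate, matrices are over $\mathbb{Q}(r)$, $\binom{k+r-1}{r}$ means $\binom{k+r-1}{k-1}=\frac{(r+1)(r+2)\cdots(r+k-1)}{(k-1)!}$, and $\binom{y}{t}=\frac{y(y-1)\cdots(y-t+1)}{t!}$ for an integer $t\ge 0$. The products are understood via $\prod_{l=0}^{s-1}(a+l)=\Gamma(a+s)/\Gamma(a)$; explicitly, for $0\le k\le j-1$, $$\frac{\prod_{l=0}^{r-3}(i+j+l)}{\prod_{l=0}^{r-2}(i+k+l)}=\frac{(i+k-1)!}{(i+j-1)!}\prod_{l=k+1}^{j-1}(i+l+r-2),$$ where the product on the right is $1$ if $k=j-1$. For integers $r\ge 2$ this agrees with the literal quotient of finite products (an empty product being $1$), and for $r=1$ it amounts to reading $\prod_{l=0}^{-2}(i+j+l)$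 as $\frac{1}{i+j-1}$. *)

theory Defs
  imports
    "HOL-Computational_Algebra.Polynomial_Factorial"
    "Jordan_Normal_Form.Matrix"
begin

(* The field Q(r) is rat poly fract.  Its characteristic is needed for the
   generalized binomial coefficient (gchoose) to be available in it. *)

lemma of_nat_fract: "(of_nat m :: 'a::idom fract) = Fract (of_nat m) 1"
  by (induction m) (simp_all add: Zero_fract_def One_fract_def)

instance fract :: ("{idom,ring_char_0}") ring_char_0
  by standard (auto simp: inj_def of_nat_fract eq_fract)

instance fract :: ("{idom,ring_char_0}") field_char_0 ..

definition indet_r :: "rat poly fract" where
  "indet_r = to_fract [:0, 1:]"

definition b_int :: "nat \<Rightarrow> nat \<Rightarrow> rat" where
  "b_int r k = of_nat ((k + r - 1) choose r)"

definition b_indet :: "nat \<Rightarrow> rat poly fract" where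
  "b_indet k = (of_nat k + indet_r - 1) gchoose (k - 1)"

(* Both readings of the symbol agree with the product formula for b_k(r). *)

lemma gchoose_shift_eq_prod:
  fixes x :: "'a::field_char_0"
  assumes "k \<ge> 1"
  shows "(of_nat k + x - 1) gchoose (k - 1) = (\<Prod>l=1..k-1. x + of_nat l) / fact (k - 1)"
proof -
  obtain m where m: "k = Suc m" using assms by (cases k) auto
  have "(\<Prod>i=0..<m. x + of_nat m - of_nat i) = (\<Prod>l=1..m. x + of_nat l)"
    by (rule prod.reindex_bij_witness[where i = "\<lambda>l. m - l" and j = "\<lambda>i. m - i"])
       (auto simp: of_nat_diff)
  then show ?thesis
    by (simp add: m gbinomial_prod_rev add.commute)
qed

lemma b_indet_eq_prod:
  "k \<ge> 1 \<Longrightarrow> b_indet k = (\<Prod>l=1..k-1. indet_r + of_nat l) / fact (k - 1)"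
  unfolding b_indet_def by (rule gchoose_shift_eq_prod)

lemma b_int_eq_prod:
  assumes "k \<ge> 1"
  shows "b_int r k = (\<Prod>l=1..k-1. of_nat r + of_nat l) / fact (k - 1)"
proof -
  have "(k + r - 1) choose r = (k + r - 1) choose (k - 1)"
    using assms by (subst binomial_symmetric) auto
  moreover have "of_nat (k + r - 1) = (of_nat k + of_nat r - 1 :: rat)"
    using assms by (simp add: of_nat_diff)
  ultimately show ?thesis
    unfolding b_int_def using gchoose_shift_eq_prod[OF assms, of "of_nat r :: rat"]
    by (simp add: binomial_gbinomial)
qed

(* Matrices of Jordan_Normal_Form are indexed from 0, hence the shifts by one
   here and in B_mat. *)

definition R_mat :: "nat \<Rightarrow> (nat \<Rightarrow> 'a::field) \<Rightarrow> 'a mat" where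
  "R_mat n b = mat n n (\<lambda>(i, j). 1 / b ((i + 1) + (j + 1) - 1))"

(* The quotient
     prod_{l=0}^{r-3} (i+j+l) / prod_{l=0}^{r-2} (i+k+l),
   with the products read as quotients of Gamma functions; this makes sense for
   an arbitrary r in a field of characteristic 0 when 0 <= k <= j - 1. *)

definition prod_quot :: "nat \<Rightarrow> nat \<Rightarrow> nat \<Rightarrow> 'a::field_char_0 \<Rightarrow> 'a" where
  "prod_quot i j k r =
     fact (i + k - 1) / fact (i + j - 1) * (\<Prod>l=k+1..j-1. of_nat i + of_nat l + r - 2)"

(* i and j are the 1-based indices. *)

definition B_entry :: "nat \<Rightarrow> 'a::field_char_0 \<Rightarrow> nat \<Rightarrow> nat \<Rightarrow> 'a" where
  "B_entry n r i j =
     (\<Sum>k=0..j-1. (- 1) ^ (i + k + 1)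
        * ((of_nat n + of_nat i + r - 2) gchoose i) * of_nat (n choose i)
        * ((of_nat n + of_nat k + r - 2) gchoose k) * of_nat (n choose k)
        * (of_nat i ^ 2 * prod_quot i j k r / r))"

definition B_mat :: "nat \<Rightarrow> 'a::field_char_0 \<Rightarrow> 'a mat" where
  "B_mat n r = mat n n (\<lambda>(i, j). B_entry n r (i + 1) (j + 1))"

(* For integers r >= 2 prod_quot is the literal quotient of products; for r = 1
   it reads prod_{l=0}^{-2} (i+j+l) as 1/(i+j-1). *)

lemma fact_mult_prod:
  assumes "a \<ge> 1"
  shows "fact (a - 1) * (\<Prod>l<s. of_nat (a + l)) = (fact (a + s - 1) :: 'a::field_char_0)"
proof (induction s)
  case (Suc s)
  have "fact (a + Suc s - 1) = (of_nat (a + s) * fact (a + s - 1) :: 'a)"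
    using assms by (cases "a + s") (simp_all add: algebra_simps)
  then show ?case using Suc by (simp add: algebra_simps)
qed (use assms in simp)

lemma prod_quot_eq_fact:
  assumes "i \<ge> 1" "k < j" "r \<ge> 1"
  shows "prod_quot i j k (of_nat r :: 'a::field_char_0) =
    fact (i + k - 1) / fact (i + j - 1) * (fact (i + j + r - 3) / fact (i + k + r - 2))"
proof -
  have "(\<Prod>l=k+1..j-1. of_nat i + of_nat l + of_nat r - 2)
      = (\<Prod>l<j - 1 - k. of_nat ((i + k + r - 1) + l) :: 'a)"
    by (rule prod.reindex_bij_witness[where i = "\<lambda>l. k + 1 + l" and j = "\<lambda>l. l - (k + 1)"])
       (use assms in \<open>auto simp: of_nat_diff algebra_simps\<close>)
  moreover have "fact (i + k + r - 2) * (\<Prod>l<j - 1 - k. of_nat ((i + k + r - 1) + l))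
      = (fact (i + j + r - 3) :: 'a)"
  proof -
    have "(i + k + r - 1) - 1 = i + k + r - 2"
      and "(i + k + r - 1) + (j - 1 - k) - 1 = i + j + r - 3"
      using assms by auto
    then show ?thesis
      using fact_mult_prod[of "i + k + r - 1" "j - 1 - k", where 'a = 'a] assms by simp
  qed
  ultimately show ?thesis
    unfolding prod_quot_def by (simp add: field_simps)
qed

lemma prod_quot_literal:
  assumes "i \<ge> 1" "k < j" "r \<ge> 2"
  shows "prod_quot i j k (of_nat r :: 'a::field_char_0) =
    (\<Prod>l<r-2. of_nat (i + j + l)) / (\<Prod>l<r-1. of_nat (i + k + l))"
proof -
  have "fact (i + j - 1) * (\<Prod>l<r-2. of_nat (i + j + l)) = (fact (i + j + r - 3) :: 'a)"
    using fact_mult_prod[of "i + j" "r - 2", where 'a = 'a] assms by (simp add: numeral_eq_Suc)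
  moreover have "fact (i + k - 1) * (\<Prod>l<r-1. of_nat (i + k + l)) = (fact (i + k + r - 2) :: 'a)"
    using fact_mult_prod[of "i + k" "r - 1", where 'a = 'a] assms by (simp add: numeral_eq_Suc)
  moreover have "prod_quot i j k (of_nat r :: 'a) =
      fact (i + k - 1) / fact (i + j - 1) * (fact (i + j + r - 3) / fact (i + k + r - 2))"
    using assms by (intro prod_quot_eq_fact) auto
  ultimately show ?thesis
    by (metis (no_types, lifting) fact_nonzero nonzero_mult_divide_mult_cancel_left
        times_divide_times_eq mult.commute mult.left_commute divide_divide_eq_left
        nonzero_mult_div_cancel_left)
qed

lemma prod_quot_one:
  assumes "i \<ge> 1" "k < j"
  shows "prod_quot i j k (1 :: 'a::field_char_0) = 1 / of_nat (i + j - 1)"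
proof -
  obtain m where m: "i + j - 1 = Suc m" "i + j - 2 = m"
    using assms by (cases "i + j - 1") auto
  have "prod_quot i j k (1 :: 'a) = fact (i + k - 1) / fact (Suc m) * (fact m / fact (i + k - 1))"
    using prod_quot_eq_fact[of i k j 1, where 'a = 'a] assms m by (simp add: numeral_eq_Suc)
  then show ?thesis unfolding m by (simp add: field_simps del: of_nat_Suc)
qed

end

(*
  Up to the factor r, the entries of R_n(b_k) are the moments of the weight (1-x)^(r-1) on [0,1].
  With P(x) = sum_k A_k x^k the Jacobi polynomial of degree n for the weight (1-x)^(r-2),
  normalized by P(0) = 1, the matrix B is the Bezoutian of P and xP':

    (y - x) sum_{i,j} B_ij x^(i-1) y^(j-1) = (x P'(x) P(y) - y P(x) P'(y)) / r.

  This is seen from the recursion in j that the defining sum over k yields, together with the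
  hypergeometric recursion of the A_k, and it shows that B is symmetric.  The displacement
  B_{i+1,j} - B_{i,j+1} and the orthogonality of P and xP' make the product R B a Toeplitz
  matrix.  Its first column is that of the identity, because B_{i,1} = -i A_i / r; it also
  satisfies the Toeplitz law with a zero column appended, because symmetry and A_{n+1} = 0 give
  B_{i,n+1} = 0, and this kills everything above the diagonal.

  All integrals are replaced by the recursions between moments that integration by parts yields,
  so that r may be any element of a field with r, r+1, r+2, ... nonzero.
*)

theory Submission
  imports Defs "Jordan_Normal_Form.Determinant"
begin

locale beta_hankel =
  fixes n :: nat and r :: "'a::field_char_0"
  assumes n_pos: "n \<ge> 1"
    and r_add_nat: "r + of_nat l \<noteq> 0"
begin

section \<open>Moments of the weight and coefficients of the Jacobi polynomial\<close>

lemma r_nonzero: "r \<noteq> 0"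
  using r_add_nat[of 0] by simp

text \<open>The integral of r x^m (1-x)^(r-1) over [0,1], which is also 1/b_{m+1}.\<close>

definition moment :: "nat \<Rightarrow> 'a" where
  "moment m = fact m / (\<Prod>l=1..m. r + of_nat l)"

definition jacobi :: "nat \<Rightarrow> 'a" where
  "jacobi k = (-1) ^ k * ((of_nat n + of_nat k + r - 2) gchoose k) * of_nat (n choose k)"

text \<open>\<open>B_entry\<close>, extended to all index pairs. The range \<open>k<j\<close> makes
  column 0 vanish, which gives the inductions on \<open>j\<close> a trivial start.\<close>

definition bez :: "nat \<Rightarrow> nat \<Rightarrow> 'a" where
  "bez i j = - (of_nat i ^ 2 * jacobi i / r * (\<Sum>k<j. jacobi k * prod_quot i j k r))"

lemma moment_0 [simp]: "moment 0 = 1"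
  by (simp add: moment_def)

lemma moment_Suc: "(r + of_nat m + 1) * moment (Suc m) = (of_nat m + 1) * moment m"
proof -
  have "r + of_nat m + 1 = r + of_nat (Suc m)"
    by simp
  moreover have "(\<Prod>l=1..Suc m. r + of_nat l) = (\<Prod>l=1..m. r + of_nat l) * (r + of_nat (Suc m))"
    by simp
  moreover have "c * (f / (p * c)) = f / p" if "c \<noteq> 0" for c f p :: 'a
    using that by simp
  ultimately have "(r + of_nat m + 1) * moment (Suc m) = fact (Suc m) / (\<Prod>l=1..m. r + of_nat l)"
    unfolding moment_def using r_add_nat[of "Suc m"] by metis
  then show ?thesis
    by (simp add: moment_def algebra_simps)
qed

lemma jacobi_0 [simp]: "jacobi 0 = 1"
  by (simp add: jacobi_def)

lemma jacobi_beyond: "k > n \<Longrightarrow> jacobi k = 0"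
  by (simp add: jacobi_def binomial_eq_0)

text \<open>Coefficient form of the hypergeometric equation x(1-x)P'' + (1-rx)P' + n(n+r-1)P =
  0.\<close>

lemma jacobi_Suc:
  "(of_nat k + 1)\<^sup>2 * jacobi (Suc k) =
   (of_nat k * (of_nat k + r - 1) - of_nat n * (of_nat n + r - 1)) * jacobi k"
proof -
  let ?a = "of_nat n + of_nat (Suc k) + r - 2"
  have 1: "(of_nat k + 1) * (?a gchoose Suc k) = ?a * ((of_nat n + of_nat k + r - 2) gchoose k)"
    using gbinomial_absorption[of k ?a] by (simp add: algebra_simps)
  have 2: "(of_nat k + 1) * (of_nat (n choose Suc k) :: 'a) = (of_nat n - of_nat k) * of_nat (n choose k)"
    using gbinomial_mult_1[of "of_nat n :: 'a" k]
    by (simp add: binomial_gbinomial algebra_simps)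
  have "(of_nat k + 1)\<^sup>2 * jacobi (Suc k) =
      - ((-1) ^ k) * ((of_nat k + 1) * (?a gchoose Suc k)) * ((of_nat k + 1) * of_nat (n choose Suc k))"
    by (simp add: jacobi_def power2_eq_square)
  also have "\<dots> = (of_nat k * (of_nat k + r - 1) - of_nat n * (of_nat n + r - 1)) * jacobi k"
    unfolding 1 2 by (simp add: jacobi_def algebra_simps)
  finally show ?thesis .
qed

section \<open>The Bezoutian: recursion, displacement and symmetry\<close>

lemma bez_j_0 [simp]: "bez i 0 = 0"
  by (simp add: bez_def)

lemma bez_i_0 [simp]: "bez 0 j = 0"
  by (simp add: bez_def)

lemma bez_beyond: "i > n \<Longrightarrow> bez i j = 0"
  by (simp add: bez_def jacobi_beyond)

lemma prod_quot_Suc: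
  assumes "i \<ge> 1" "k < j"
  shows "(of_nat i + of_nat j) * prod_quot i (Suc j) k r =
    (of_nat i + of_nat j + r - 2) * prod_quot i j k r"
proof -
  obtain t where t: "j = Suc t" using assms by (cases j) auto
  have "fact (i + j) = (of_nat i + of_nat j) * (fact (i + j - 1) :: 'a)"
    by (simp add: t algebra_simps)
  moreover have "(of_nat i + of_nat j :: 'a) \<noteq> 0"
    using assms by (metis of_nat_add of_nat_eq_0_iff add_is_0 not_one_le_zero)
  moreover have "(\<Prod>l=k+1..j. of_nat i + of_nat l + r - 2)
      = (\<Prod>l=k+1..j-1. of_nat i + of_nat l + r - 2) * (of_nat i + of_nat j + r - 2)"
    using assms by (simp add: t)
  moreover have "c * (f / (c * g) * (p * d)) = d * (f / g * p)" if "c \<noteq> 0" for c d f g p :: 'a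
    using that by simp
  ultimately show ?thesis
    by (simp only: prod_quot_def diff_Suc_1 add_Suc_right)
qed

lemma prod_quot_diag:
  assumes "i \<ge> 1"
  shows "(of_nat i + of_nat j) * prod_quot i (Suc j) j r = 1"
proof -
  obtain t where t: "i = Suc t" using assms by (cases i) auto
  have "(1 + of_nat t + of_nat j :: 'a) \<noteq> 0"
    by (metis of_nat_Suc of_nat_add of_nat_eq_0_iff add_is_0 nat.distinct(2))
  then show ?thesis
    by (simp add: prod_quot_def t add.assoc add.commute add.left_commute)
qed

text \<open>Passing from \<open>j\<close> to \<open>Suc j\<close> multiplies every old summand by
  (i+j+r-2)/(i+j); the new summand \<open>k = j\<close> gives the inhomogeneous term.\<close>

lemma bez_Suc:
  "(of_nat i + of_nat j) * bez i (Suc j) =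
   (of_nat i + of_nat j + r - 2) * bez i j - of_nat i ^ 2 * jacobi i * jacobi j / r"
proof (cases "i = 0")
  case False
  then have i: "i \<ge> 1" by simp
  let ?c = "of_nat i ^ 2 * jacobi i / r"
  have "(of_nat i + of_nat j) * (\<Sum>k<j. jacobi k * prod_quot i (Suc j) k r)
      = (of_nat i + of_nat j + r - 2) * (\<Sum>k<j. jacobi k * prod_quot i j k r)"
    unfolding sum_distrib_left
    using prod_quot_Suc[OF i] by (intro sum.cong) (auto simp: mult.left_commute)
  moreover have "(of_nat i + of_nat j) * (jacobi j * prod_quot i (Suc j) j r) = jacobi j"
    using prod_quot_diag[OF i, of j] by (simp add: mult.left_commute)
  ultimately have "(of_nat i + of_nat j) * (\<Sum>k<Suc j. jacobi k * prod_quot i (Suc j) k r)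
      = (of_nat i + of_nat j + r - 2) * (\<Sum>k<j. jacobi k * prod_quot i j k r) + jacobi j"
    by (simp add: distrib_left)
  moreover have "x * - (c * S') = d * - (c * S) - c * a" if "x * S' = d * S + a" for x c S S' d a :: 'a
  proof -
    have "x * - (c * S') = - c * (x * S')" by simp
    then show ?thesis unfolding that by (simp add: algebra_simps)
  qed
  ultimately have "(of_nat i + of_nat j) * bez i (Suc j) = (of_nat i + of_nat j + r - 2) * bez i j - ?c * jacobi j"
    unfolding bez_def by blast
  then show ?thesis by simp
qed simp

lemma bez_1: "bez i 1 = - (of_nat i * jacobi i / r)"
proof (cases "i = 0")
  case False
  have "of_nat i * bez i 1 = of_nat i * - (of_nat i * jacobi i / r)"
    using bez_Suc[of i 0] by (simp add: power2_eq_square mult.assoc)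
  then show ?thesis
    using False by (metis mult_left_cancel of_nat_eq_0_iff)
qed simp

text \<open>The Bezoutian identity, read off at x^i y^j. On the antidiagonal, \<open>bez_Suc\<close>
  has the same two factors for both entries, so their difference satisfies a recursion of its
  own.\<close>

lemma bez_displacement:
  "bez (Suc i) j - bez i (Suc j) = (of_nat i - of_nat j) * jacobi i * jacobi j / r"
proof (induction j)
  case 0
  then show ?case using bez_1[of i] by simp
next
  case (Suc j)
  let ?i = "of_nat i :: 'a" and ?j = "of_nat j :: 'a"
  let ?lam = "of_nat n * (of_nat n + r - 1)"
  have nz: "?i + ?j + 1 \<noteq> 0"
    by (metis of_nat_Suc of_nat_add of_nat_eq_0_iff nat.distinct(2) add.commute)
  have 1: "(?i + ?j + 1) * bez (Suc i) (Suc j) =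
      (?i + ?j + r - 1) * bez (Suc i) j - ((?i + 1)\<^sup>2 * jacobi (Suc i)) * jacobi j / r"
    using bez_Suc[of "Suc i" j] by (simp add: algebra_simps)
  have 2: "(?i + ?j + 1) * bez i (Suc (Suc j)) =
      (?i + ?j + r - 1) * bez i (Suc j) - ?i\<^sup>2 * jacobi i * jacobi (Suc j) / r"
    using bez_Suc[of i "Suc j"] by (simp add: algebra_simps)
  have "(?i + ?j + 1) * (bez (Suc i) (Suc j) - bez i (Suc (Suc j)))
     = (?i + ?j + r - 1) * (bez (Suc i) j - bez i (Suc j))
       - ((?i + 1)\<^sup>2 * jacobi (Suc i)) * jacobi j / r + ?i\<^sup>2 * jacobi i * jacobi (Suc j) / r"
    unfolding right_diff_distrib 1 2 by simp
  \<comment> \<open>As (i+j+r-1)(i-j) = i(i+r-1) - j(j+r-1), the recursion for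
    \<open>jacobi (Suc i)\<close> cancels the part in i; what remains is the recursion for
    \<open>jacobi (Suc j)\<close>.\<close>
  also have "\<dots> = (?i\<^sup>2 * jacobi i * jacobi (Suc j)
      - jacobi i * ((?j * (?j + r - 1) - ?lam) * jacobi j)) / r"
    unfolding Suc.IH jacobi_Suc using r_nonzero
    by (simp add: field_simps power2_eq_square)
  also have "\<dots> = (?i + ?j + 1) * ((of_nat i - of_nat (Suc j)) * jacobi i * jacobi (Suc j) / r)"
    unfolding jacobi_Suc[symmetric] using r_nonzero
    by (simp add: field_simps power2_eq_square)
  finally show ?case using nz by (metis mult_left_cancel)
qed

text \<open>The displacement is antisymmetric in \<open>i\<close> and \<open>j\<close>, so symmetry
  propagates along antidiagonals from the zero border.\<close>

lemma bez_sym: "bez i j = bez j i"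
proof (induction j arbitrary: i)
  case (Suc j)
  have "bez i (Suc j) = bez (Suc i) j - (of_nat i - of_nat j) * jacobi i * jacobi j / r"
    using bez_displacement[of i j] by (simp add: algebra_simps)
  also have "\<dots> = bez j (Suc i) + (of_nat j - of_nat i) * jacobi j * jacobi i / r"
    using Suc.IH[of "Suc i"] r_nonzero by (simp add: field_simps)
  also have "\<dots> = bez (Suc j) i"
    using bez_displacement[of j i] by (simp add: algebra_simps)
  finally show ?case .
qed simp

section \<open>Moment recursions and orthogonality\<close>

text \<open>The linear functional given by the moments, applied to \<open>x\<^sup>m P\<close> and to \<open>x\<^sup>m P'\<close>.\<close>

definition jac_moment :: "nat \<Rightarrow> 'a" where
  "jac_moment m = (\<Sum>k\<le>n. jacobi k * moment (m + k))"

definition jac_deriv_moment :: "nat \<Rightarrow> 'a" where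
  "jac_deriv_moment m = (\<Sum>k<n. (of_nat k + 1) * jacobi (Suc k) * moment (m + k))"

lemma deriv_moment_Suc:
  "jac_deriv_moment (Suc m) = (\<Sum>k\<le>n. of_nat k * jacobi k * moment (m + k))"
  unfolding jac_deriv_moment_def lessThan_Suc_atMost[symmetric] sum.lessThan_Suc_shift
  by (simp add: algebra_simps)

text \<open>Integration by parts of (x^(m+1) P)' against (1-x)^r; both boundary terms
  vanish.\<close>

lemma pearson:
  "jac_deriv_moment (Suc (Suc m)) + (r + of_nat m + 1) * jac_moment (Suc m)
   = jac_deriv_moment (Suc m) + (of_nat m + 1) * jac_moment m"
proof -
  have "jacobi k * ((r + of_nat (m + k) + 1) * moment (Suc (m + k)))
      = jacobi k * ((of_nat (m + k) + 1) * moment (m + k))" for k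
    using moment_Suc[of "m + k"] by simp
  then show ?thesis
    unfolding deriv_moment_Suc jac_moment_def sum_distrib_left sum.distrib[symmetric]
    by (intro sum.cong) (auto simp: algebra_simps)
qed

text \<open>The same for P' against (1-x)^r, where the boundary term at 0 contributes r P(0) =
  r.\<close>

lemma pearson_0: "jac_deriv_moment 1 + r * jac_moment 0 = r + jac_deriv_moment 0"
proof -
  have "jac_deriv_moment 1 + r * jac_moment 0 = (\<Sum>k<Suc n. (r + of_nat k) * jacobi k * moment k)"
    using deriv_moment_Suc[of 0]
    by (simp add: jac_moment_def lessThan_Suc_atMost sum_distrib_left sum.distrib[symmetric] algebra_simps
             del: sum.lessThan_Suc)
  also have "\<dots> = r + (\<Sum>k<n. jacobi (Suc k) * ((r + of_nat k + 1) * moment (Suc k)))"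
    unfolding sum.lessThan_Suc_shift by (simp add: algebra_simps)
  also have "\<dots> = r + jac_deriv_moment 0"
    unfolding moment_Suc jac_deriv_moment_def by (simp add: algebra_simps)
  finally show ?thesis .
qed

text \<open>The functional applied to x^m times the differential equation, with P'' removed by
  integration by parts.\<close>

lemma hypergeometric_moments:
  "(of_nat m + 1) * jac_deriv_moment (Suc m) + of_nat n * (of_nat n + r - 1) * jac_moment m
   = of_nat m * jac_deriv_moment m"
proof -
  let ?lam = "of_nat n * (of_nat n + r - 1)"
  \<comment> \<open>\<open>U\<close> and \<open>V\<close> are the functional at x^m (xP')' and
    x^(m+1) (xP')'. The differential equation gives one expression for \<open>U - V\<close>,
    integration by parts another.\<close>
  define U where "U = (\<Sum>k<n. (of_nat k + 1)\<^sup>2 * jacobi (Suc k) * moment (m + k))"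
  define V where "V = (\<Sum>k\<le>n. of_nat k ^ 2 * jacobi k * moment (m + k))"
  have V: "V = (\<Sum>k<n. (of_nat k + 1)\<^sup>2 * jacobi (Suc k) * moment (Suc (m + k)))"
    unfolding V_def lessThan_Suc_atMost[symmetric] sum.lessThan_Suc_shift
    by (simp add: algebra_simps)
  have "U = (\<Sum>k\<le>n. (of_nat k + 1)\<^sup>2 * jacobi (Suc k) * moment (m + k))"
    unfolding U_def lessThan_Suc_atMost[symmetric] by (simp add: jacobi_beyond)
  also have "\<dots> = V + (r - 1) * jac_deriv_moment (Suc m) - ?lam * jac_moment m"
    unfolding jacobi_Suc V_def deriv_moment_Suc jac_moment_def sum_distrib_left
      sum.distrib[symmetric] sum_subtractf[symmetric]
    by (intro sum.cong) (auto simp: algebra_simps power2_eq_square)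
  finally have 1: "U = V + (r - 1) * jac_deriv_moment (Suc m) - ?lam * jac_moment m" .
  have step: "(of_nat k + 1) * jacobi (Suc k) * ((r + of_nat (m + k) + 1) * moment (Suc (m + k)))
      = (of_nat k + 1) * jacobi (Suc k) * ((of_nat (m + k) + 1) * moment (m + k))" for k
    using moment_Suc[of "m + k"] by simp
  have 2: "V + (r + of_nat m) * jac_deriv_moment (Suc m) = U + of_nat m * jac_deriv_moment m"
    unfolding V U_def jac_deriv_moment_def sum_distrib_left sum.distrib[symmetric]
    using step by (intro sum.cong) (auto simp: algebra_simps power2_eq_square)
  have "(of_nat m + 1) * jac_deriv_moment (Suc m) + ?lam * jac_moment m
      = (V + (r + of_nat m) * jac_deriv_moment (Suc m))
        - (V + (r - 1) * jac_deriv_moment (Suc m) - ?lam * jac_moment m)"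
    by (simp add: algebra_simps)
  also have "\<dots> = of_nat m * jac_deriv_moment m"
    unfolding 2 1[symmetric] by simp
  finally show ?thesis .
qed

text \<open>Formally, orthogonality of P to the constants for (1-x)^(r-2), integrated by parts; for
  r = 1 it says P(1) = 0. The series is summed directly: the closed form of its partial sums
  contains \<open>jacobi (Suc m)\<close>, which is 0 at \<open>m = n\<close>.\<close>

lemma deriv_moment_0: "jac_deriv_moment 0 = - r"
proof -
  let ?lam = "of_nat n * (of_nat n + r - 1)"
  \<comment> \<open>Gosper's summation of the Chu--Vandermonde series\<close>
  have partial: "?lam * (r + (\<Sum>k<m. (of_nat k + 1) * jacobi (Suc k) * moment k))
      = - (r + of_nat m) * ((of_nat m + 1)\<^sup>2 * jacobi (Suc m)) * moment m" for m
  proof (induction m)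
    case 0
    then show ?case
      using jacobi_Suc[of 0] by simp
  next
    case (Suc m)
    have "?lam * (r + (\<Sum>k<Suc m. (of_nat k + 1) * jacobi (Suc k) * moment k))
        = (?lam - (r + of_nat m) * (of_nat m + 1)) * jacobi (Suc m) * ((of_nat m + 1) * moment m)"
      using Suc.IH by (simp add: distrib_left algebra_simps power2_eq_square)
    also have "\<dots> = (?lam - (r + of_nat m) * (of_nat m + 1)) * jacobi (Suc m)
        * ((r + of_nat m + 1) * moment (Suc m))"
      unfolding moment_Suc ..
    also have "\<dots> = - (r + of_nat (Suc m))
        * ((of_nat (Suc m) + 1)\<^sup>2 * jacobi (Suc (Suc m))) * moment (Suc m)"
      unfolding jacobi_Suc[of "Suc m"] by (simp add: algebra_simps)
    finally show ?case .
  qed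
  have "of_nat n + r - 1 \<noteq> 0"
    using r_add_nat[of "n - 1"] n_pos by (simp add: of_nat_diff algebra_simps)
  moreover have "?lam * (r + jac_deriv_moment 0) = 0"
    using partial[of n] by (simp add: jac_deriv_moment_def jacobi_beyond)
  ultimately have "r + jac_deriv_moment 0 = 0"
    using n_pos by simp
  then show ?thesis
    by (simp add: add_eq_0_iff)
qed

text \<open>Once the earlier values vanish, the two moment recursions form a homogeneous linear
  system for the pair, with determinant (n-m-1)(r+n+m) up to sign. It is nonzero for m+1 <
  n.\<close>

lemma jacobi_orthogonal:
  "Suc m < n \<Longrightarrow> jac_moment m = 0 \<and> jac_deriv_moment (Suc m) = 0"
proof (induction m)
  case 0
  have eq: "jac_deriv_moment 1 + of_nat n * (of_nat n + r - 1) * jac_moment 0 = 0"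
    "jac_deriv_moment 1 + r * jac_moment 0 = 0"
    using hypergeometric_moments[of 0] pearson_0 deriv_moment_0 by simp_all
  have "(of_nat n - 1) * (r + of_nat n) * jac_moment 0 =
      (jac_deriv_moment 1 + of_nat n * (of_nat n + r - 1) * jac_moment 0)
      - (jac_deriv_moment 1 + r * jac_moment 0)"
    by (simp add: algebra_simps)
  also have "\<dots> = 0"
    unfolding eq by simp
  finally have "(of_nat n - 1) * (r + of_nat n) * jac_moment 0 = 0" .
  moreover have "(of_nat n - 1 :: 'a) \<noteq> 0"
    using 0 by simp
  ultimately have "jac_moment 0 = 0"
    using r_add_nat by simp
  then show ?case using eq by simp
next
  case (Suc m)
  then have IH: "jac_moment m = 0" "jac_deriv_moment (Suc m) = 0" by auto
  let ?q = "jac_moment (Suc m)" and ?p = "jac_deriv_moment (Suc (Suc m))"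
  have eq: "(of_nat m + 2) * ?p + of_nat n * (of_nat n + r - 1) * ?q = 0"
    "?p + (r + of_nat m + 1) * ?q = 0"
    using hypergeometric_moments[of "Suc m"] pearson[of m] IH by (simp_all add: add.commute)
  have "(of_nat n - of_nat (m + 2)) * (r + of_nat (n + m + 1)) * ?q =
      ((of_nat m + 2) * ?p + of_nat n * (of_nat n + r - 1) * ?q)
      - (of_nat m + 2) * (?p + (r + of_nat m + 1) * ?q)"
    by (simp add: algebra_simps)
  also have "\<dots> = 0"
    unfolding eq by simp
  finally have "(of_nat n - of_nat (m + 2)) * (r + of_nat (n + m + 1)) * ?q = 0" .
  moreover have "(of_nat n - of_nat (m + 2) :: 'a) \<noteq> 0"
    using Suc.prems by (metis add_2_eq_Suc' eq_iff_diff_eq_0 nat_neq_iff of_nat_eq_iff)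
  ultimately have "?q = 0"
    using r_add_nat by (metis mult_eq_0_iff)
  then show ?case using eq by simp
qed

section \<open>The product of the Hankel matrix and the Bezoutian\<close>

definition hankel_bez :: "nat \<Rightarrow> nat \<Rightarrow> 'a" where
  "hankel_bez m j = (\<Sum>i<n. moment (m + i) * bez (Suc i) (Suc j))"

lemma hankel_bez_first_col:
  assumes "m < n"
  shows "hankel_bez m 0 = (if m = 0 then 1 else 0)"
proof -
  have "hankel_bez m 0 = - (jac_deriv_moment m / r)"
    unfolding hankel_bez_def jac_deriv_moment_def sum_divide_distrib sum_negf[symmetric]
    using bez_1 by (intro sum.cong) (auto simp: algebra_simps)
  moreover have "jac_deriv_moment m = 0" if "m \<noteq> 0"
    using that assms jacobi_orthogonal[of "m - 1"] by simp
  ultimately show ?thesis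
    using deriv_moment_0 r_nonzero by simp
qed

text \<open>Columns are counted from 0 here, so column \<open>n\<close> is the one just outside the
  matrix; symmetry turns it into row n+1 of \<open>bez\<close>.\<close>

lemma hankel_bez_past_last_col: "hankel_bez m n = 0"
  unfolding hankel_bez_def by (simp add: bez_sym[of _ "Suc n"] bez_beyond)

text \<open>The displacement trades a column shift for a row shift. Orthogonality reduces the
  correction to a multiple of \<open>moment m\<close>, which cancels the first term lost in the row
  shift.\<close>

lemma hankel_bez_Suc_Suc:
  assumes "Suc m < n"
  shows "hankel_bez (Suc m) (Suc j) = hankel_bez m j"
proof -
  have disp: "bez (Suc i) (Suc (Suc j)) = bez (Suc (Suc i)) (Suc j)
      - (of_nat (Suc i) - of_nat (Suc j)) * jacobi (Suc i) * jacobi (Suc j) / r" for i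
    using bez_displacement[of "Suc i" "Suc j"] by (simp add: algebra_simps)
  have "(\<Sum>i<n. moment (m + Suc i) * bez (Suc (Suc i)) (Suc j))
      = (\<Sum>i<Suc n. moment (m + i) * bez (Suc i) (Suc j)) - moment m * bez 1 (Suc j)"
    unfolding sum.lessThan_Suc_shift by simp
  then have shifted: "(\<Sum>i<n. moment (m + Suc i) * bez (Suc (Suc i)) (Suc j))
      = hankel_bez m j - moment m * bez 1 (Suc j)"
    by (simp add: hankel_bez_def bez_beyond)
  \<comment> \<open>The sum starts at x^1, so orthogonality leaves minus the contribution of P(0) =
    1.\<close>
  have "jac_moment m = moment m + (\<Sum>i<n. jacobi (Suc i) * moment (m + Suc i))"
    unfolding jac_moment_def lessThan_Suc_atMost[symmetric] sum.lessThan_Suc_shift by simp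
  then have q: "(\<Sum>i<n. jacobi (Suc i) * moment (m + Suc i)) = - moment m"
    using jacobi_orthogonal[OF assms] by (simp add: add_eq_0_iff)
  have p: "(\<Sum>i<n. of_nat (Suc i) * jacobi (Suc i) * moment (m + Suc i)) = 0"
    using jacobi_orthogonal[OF assms] by (simp add: jac_deriv_moment_def add.commute)
  have "hankel_bez (Suc m) (Suc j)
      = (\<Sum>i<n. moment (m + Suc i) * bez (Suc (Suc i)) (Suc j))
        - jacobi (Suc j) / r * ((\<Sum>i<n. of_nat (Suc i) * jacobi (Suc i) * moment (m + Suc i))
        - of_nat (Suc j) * (\<Sum>i<n. jacobi (Suc i) * moment (m + Suc i)))"
    unfolding hankel_bez_def disp sum_distrib_left sum_subtractf[symmetric]
    using r_nonzero by (intro sum.cong) (auto simp: field_simps)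
  also have "\<dots> = hankel_bez m j"
    unfolding shifted p q bez_sym[of 1] bez_1 by simp
  finally show ?thesis .
qed

lemma hankel_bez_shift: "m + d < n \<Longrightarrow> hankel_bez (m + d) (j + d) = hankel_bez m j"
  by (induction d) (simp_all add: hankel_bez_Suc_Suc)

lemma hankel_bez:
  assumes "m < n" "j < n"
  shows "hankel_bez m j = (if m = j then 1 else 0)"
proof (cases "j \<le> m")
  case True
  then have "hankel_bez m j = hankel_bez (m - j) 0"
    using hankel_bez_shift[of "m - j" j 0] assms by simp
  then show ?thesis
    using hankel_bez_first_col[of "m - j"] assms True by auto
next
  case False
  \<comment> \<open>Above the diagonal, moving down by n-j reaches column \<open>n\<close> while the
    row stays below \<open>n\<close>, because m < j.\<close>
  then have "hankel_bez m j = hankel_bez (m + (n - j)) n"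
    using hankel_bez_shift[of m "n - j" j] assms by simp
  then show ?thesis
    using hankel_bez_past_last_col False by simp
qed

section \<open>Passage to the matrices\<close>

lemma B_entry_eq_bez:
  assumes "j \<ge> 1"
  shows "B_entry n r i j = bez i j"
proof -
  have "{0..j - 1} = {..<j}" using assms by auto
  then show ?thesis
    unfolding B_entry_def bez_def sum_distrib_left sum_negf[symmetric]
    by (intro sum.cong) (auto simp: jacobi_def power_add)
qed

text \<open>The product formula for b covers both readings of the binomial coefficient and turns 1/b
  into \<open>moment\<close>. For square matrices over a field, a right inverse is also a left
  inverse.\<close>

lemma inverse_R_mat:
  assumes b: "\<And>k. k \<ge> 1 \<Longrightarrow> b k = (\<Prod>l=1..k-1. r + of_nat l) / fact (k - 1)"
  shows "inverts_mat (R_mat n b) (B_mat n r) \<and> inverts_mat (B_mat n r) (R_mat n b)"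
proof -
  have carrier: "R_mat n b \<in> carrier_mat n n" "B_mat n r \<in> carrier_mat n n"
    by (auto simp: R_mat_def B_mat_def)
  have "R_mat n b * B_mat n r = 1\<^sub>m n"
  proof (rule eq_matI)
    fix m j assume "m < dim_row (1\<^sub>m n)" "j < dim_col (1\<^sub>m n)"
    then have mj: "m < n" "j < n" by auto
    have "(R_mat n b * B_mat n r) $$ (m, j) = hankel_bez m j"
      using mj unfolding hankel_bez_def
      by (auto simp: R_mat_def B_mat_def scalar_prod_def b moment_def B_entry_eq_bez
            lessThan_atLeast0 intro!: sum.cong)
    then show "(R_mat n b * B_mat n r) $$ (m, j) = 1\<^sub>m n $$ (m, j)"
      using hankel_bez[OF mj] mj by simp
  qed (auto simp: R_mat_def B_mat_def)
  moreover from this have "B_mat n r * R_mat n b = 1\<^sub>m n"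
    by (rule mat_mult_left_right_inverse[OF carrier])
  ultimately show ?thesis
    using carrier by (auto simp: inverts_mat_def)
qed

end

text \<open>The locale assumption for the indeterminate: r + l comes from a polynomial of degree
  one.\<close>

lemma indet_r_add_nat: "indet_r + of_nat l \<noteq> 0"
proof -
  have "indet_r + of_nat l = to_fract ([:0, 1:] + of_nat l)"
    by (simp add: indet_r_def of_nat_fract to_fract_def)
  moreover have "[:0, 1:] + of_nat l \<noteq> (0 :: rat poly)"
    by (simp add: of_nat_poly)
  ultimately show ?thesis
    by (simp only: to_fract_eq_0_iff) simp
qed

theorem theorem5p2:
  fixes n :: nat
  assumes "n \<ge> 1"
  shows "(\<forall>r::nat. r \<ge> 1 \<longrightarrow>
            inverts_mat (R_mat n (b_int r)) (B_mat n (of_nat r :: rat)) \<and>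
            inverts_mat (B_mat n (of_nat r :: rat)) (R_mat n (b_int r)))
       \<and> inverts_mat (R_mat n b_indet) (B_mat n indet_r)
       \<and> inverts_mat (B_mat n indet_r) (R_mat n b_indet)"
proof (intro conjI allI impI)
  fix r :: nat assume r: "r \<ge> 1"
  interpret beta_hankel n "of_nat r :: rat"
    using assms r by unfold_locales (auto simp flip: of_nat_add)
  show "inverts_mat (R_mat n (b_int r)) (B_mat n (of_nat r :: rat))"
    "inverts_mat (B_mat n (of_nat r :: rat)) (R_mat n (b_int r))"
    using inverse_R_mat[OF b_int_eq_prod] by blast+
next
  interpret beta_hankel n indet_r
    using assms indet_r_add_nat by unfold_locales
  show "inverts_mat (R_mat n b_indet) (B_mat n indet_r)"
    "inverts_mat (B_mat n indet_r) (R_mat n b_indet)"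
    using inverse_R_mat[OF b_indet_eq_prod] by blast+
qed

end
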